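(* Let $\alpha<\beta$ be real numbers with $\alpha\beta\neq 0$, and let $$A_{\alpha,\beta}=\sup_{f\in\mathcal A}\frac{R_{\alpha,\beta}(\overline f)}{P_{\alpha,\beta}(f)} .$$ Then $A_{\alpha,\beta}\le \overline A_{\alpha,\beta}$, where $$\overline A_{\alpha,\beta}=\begin{cases}2^{\frac1\alpha} & \text{if } 0<\alpha<\beta,\\ 2^{-\frac1\beta} & \text{if } \alpha<\beta<0,\\ 2^{\frac1\beta-\frac1\alpha} & \text{if } \alpha<0<\beta.\end{cases}$$
   Context: $\mathbb R_+=(0,+\infty)$; all intervals $I$ are bounded and of positive length, and $|I|$ is Lebesgue measure. For $\alpha\neq 0$ and a non-negative function $f$ on $I$, $M_{I,\alpha}(f)=\left(\frac1{|I|}\int_I f^\alpha(x)\,dx\right)^{1/\alpha}$. For $\alpha<\beta$, $\alpha\beta\ne0$, and a non-negative function $f$ on $\mathbb R_+$, let $P_{\alpha,\beta}(f)=\sup_{I\subset\mathbb R_+}\frac{M_{I,\beta}(f)}{M_{I,\alpha}(f)}$, the supremum being over all intervals $I\subset\mathbb R_+$. The even extension of $f$ is $\overline f(x)=f(|x|)$, $x\neq0$ (the value at $0$ is irrelevant), and $R_{\alpha,\beta}(\overline f)=\sup_{I\subset\mathbb R}\frac{M_{I,\beta}(\overline f)}{M_{I,\alpha}(\overline f)}$, the supremum being over all intervals $I\subset\mathbb R$. $\mathcal A$ denotes the class of all non-negative measurable functions $f$ on $(0,+\infty)$ for which the means $M_{I,\alpha}(f)$, $M_{I,\beta}(f)$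 are finite and positive for every bounded interval $I\subset\mathbb R_+$ (including intervals $(0,b)$) and $P_{\alpha,\beta}(f)<+\infty$ (the Reverse Hölder Inequality). *)

theory Defs
  imports "HOL-Analysis.Analysis"
begin

text \<open>
  Power with real exponent on the extended half-line, with the usual conventions for
  \<open>a > 0\<close>: \<open>0\<^sup>a = 0\<close> and \<open>\<infinity>\<^sup>a = \<infinity>\<close>, and for \<open>a < 0\<close>: \<open>0\<^sup>a = \<infinity>\<close> and \<open>\<infinity>\<^sup>a = 0\<close>.
  (The library function \<open>powr\<close> on the reals has \<open>0 powr a = 0\<close> also for negative \<open>a\<close>,
  so it cannot be used directly for negative exponents.)
\<close>

definition epowr :: "ennreal \<Rightarrow> real \<Rightarrow> ennreal" where
  "epowr x a =
     (if a = 0 then 1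
      else if x = 0 then (if 0 < a then 0 else \<infinity>)
      else if x = \<infinity> then (if 0 < a then \<infinity> else 0)
      else ennreal (enn2real x powr a))"

text \<open>
  Bounded intervals of positive length; open, closed and half-open ones are all allowed.
\<close>

definition bdd_interval :: "real set \<Rightarrow> bool" where
  "bdd_interval I \<longleftrightarrow> is_interval I \<and> bounded I \<and> 0 < measure lebesgue I"

text \<open>
  The mean is extended-real valued, so that "finite and positive" is a genuine condition
  on \<open>f\<close>, and no convention for divergent integrals enters.
\<close>

definition power_mean :: "real set \<Rightarrow> real \<Rightarrow> (real \<Rightarrow> real) \<Rightarrow> ennreal" where
  "power_mean I a f =
     epowr ((\<integral>\<^sup>+x\<in>I. epowr (ennreal (f x)) a \<partial>lebesgue) / emeasure lebesgue I) (1 / a)"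

definition P_const :: "real \<Rightarrow> real \<Rightarrow> (real \<Rightarrow> real) \<Rightarrow> ennreal" where
  "P_const \<alpha> \<beta> f =
     (SUP I \<in> {I. bdd_interval I \<and> I \<subseteq> {0<..}}. power_mean I \<beta> f / power_mean I \<alpha> f)"

definition R_const :: "real \<Rightarrow> real \<Rightarrow> (real \<Rightarrow> real) \<Rightarrow> ennreal" where
  "R_const \<alpha> \<beta> g =
     (SUP I \<in> {I. bdd_interval I}. power_mean I \<beta> g / power_mean I \<alpha> g)"

definition even_ext :: "(real \<Rightarrow> real) \<Rightarrow> real \<Rightarrow> real" where
  "even_ext f x = f \<bar>x\<bar>"

text \<open>
  Functions on the positive half-line are represented by total functions; all conditions
  concern their values on \<open>{0<..}\<close> only.
\<close>

definition RHI_class :: "real \<Rightarrow> real \<Rightarrow> (real \<Rightarrow> real) set" where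
  "RHI_class \<alpha> \<beta> =
     {f. (\<forall>x>0. 0 \<le> f x) \<and>
         f \<in> borel_measurable (lebesgue_on {0<..}) \<and>
         (\<forall>I. bdd_interval I \<and> I \<subseteq> {0<..} \<longrightarrow>
              0 < power_mean I \<alpha> f \<and> power_mean I \<alpha> f < \<infinity> \<and>
              0 < power_mean I \<beta> f \<and> power_mean I \<beta> f < \<infinity>) \<and>
         P_const \<alpha> \<beta> f < \<infinity>}"

definition A_const :: "real \<Rightarrow> real \<Rightarrow> ennreal" where
  "A_const \<alpha> \<beta> =
     (SUP f \<in> RHI_class \<alpha> \<beta>. R_const \<alpha> \<beta> (even_ext f) / P_const \<alpha> \<beta> f)"

text \<open>
  The last branch is meant for \<open>\<alpha> < 0 < \<beta>\<close>, the only case left when \<open>\<alpha> < \<beta>\<close> and \<open>\<alpha> * \<beta> \<noteq> 0\<close>.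
\<close>

definition A_bound :: "real \<Rightarrow> real \<Rightarrow> real" where
  "A_bound \<alpha> \<beta> =
     (if 0 < \<alpha> then 2 powr (1 / \<alpha>)
      else if \<beta> < 0 then 2 powr (- 1 / \<beta>)
      else 2 powr (1 / \<beta> - 1 / \<alpha>))"

end

theory Submission
  imports Defs
begin

text \<open>
  Folding an interval \<open>I\<close> at the origin gives the interval \<open>J = {\<bar>x\<bar> | x \<in> I} - {0}\<close> in the positive
  half-line. The map \<open>x \<mapsto> \<bar>x\<bar>\<close> covers \<open>J\<close> at least once and at most twice, so the integral of any
  non-negative even function over \<open>I\<close> lies between one and two times its integral over \<open>J\<close>.
  Applied to the constant 1 this gives \<open>t = \<bar>J\<bar> / \<bar>I\<bar> \<in> [1/2, 1]\<close>, so each average over \<open>I\<close> lies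
  between \<open>t\<close> and \<open>2 t\<close> times the corresponding average over \<open>J\<close>. What remains is an elementary
  inequality for powers.
\<close>

text \<open>\<open>u\<close> and \<open>v\<close> stand for the factors by which the averages of the
  \<beta>-th and \<alpha>-th powers change under unfolding. Each is replaced by its worst value in
  \<open>[t, 2 * t]\<close>, which depends on the sign of its exponent.\<close>

lemma powr_le_A_bound:
  fixes \<alpha> \<beta> t u v :: real
  assumes ab: "\<alpha> < \<beta>" "\<alpha> * \<beta> \<noteq> 0" and t: "1 / 2 \<le> t" "t \<le> 1"
    and u: "t \<le> u" "u \<le> 2 * t" and v: "t \<le> v" "v \<le> 2 * t"
  shows "u powr (1 / \<beta>) \<le> A_bound \<alpha> \<beta> * v powr (1 / \<alpha>)"
proof -
  consider "0 < \<alpha>" | "\<beta> < 0" | "\<alpha> < 0" "0 < \<beta>"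
    using ab by fastforce
  then show ?thesis
  proof cases
    case 1
    have "u powr (1 / \<beta>) \<le> (2 * t) powr (1 / \<beta>)"
      using 1 ab t u by (intro powr_mono2) auto
    \<comment> \<open>The base satisfies \<open>2 * t \<ge> 1\<close>, and reciprocals reverse the
      order of numbers of equal sign.\<close>
    also have "\<dots> \<le> (2 * t) powr (1 / \<alpha>)"
      using 1 ab t by (intro powr_mono) (auto simp: field_simps)
    also have "\<dots> = 2 powr (1 / \<alpha>) * t powr (1 / \<alpha>)"
      using t by (simp add: powr_mult)
    also have "\<dots> \<le> 2 powr (1 / \<alpha>) * v powr (1 / \<alpha>)"
      using 1 t v by (intro mult_left_mono powr_mono2) auto
    finally show ?thesis
      using 1 by (simp add: A_bound_def)
  next
    case 2
    have "u powr (1 / \<beta>) \<le> t powr (1 / \<beta>)"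
      using 2 t u by (intro powr_mono2') auto
    \<comment> \<open>Splitting off a power of 2 makes the base at least 1, so that the power
      increases with the exponent.\<close>
    also have "\<dots> = 2 powr (- 1 / \<beta>) * (2 * t) powr (1 / \<beta>)"
      using t by (simp add: powr_mult powr_minus)
    also have "\<dots> \<le> 2 powr (- 1 / \<beta>) * (2 * t) powr (1 / \<alpha>)"
      using 2 ab t by (intro mult_left_mono powr_mono) (auto simp: field_simps)
    also have "\<dots> \<le> 2 powr (- 1 / \<beta>) * v powr (1 / \<alpha>)"
      using 2 ab t v by (intro mult_left_mono powr_mono2') auto
    finally show ?thesis
      using 2 ab by (simp add: A_bound_def)
  next
    case 3
    have "1 / \<alpha> < 0" "0 < 1 / \<beta>"
      using 3 by auto
    then have "0 \<le> 1 / \<beta> - 1 / \<alpha>"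
      by linarith
    have "u powr (1 / \<beta>) \<le> (2 * t) powr (1 / \<beta>)"
      using 3 t u by (intro powr_mono2) auto
    also have "\<dots> = (2 * t) powr (1 / \<beta> - 1 / \<alpha>) * (2 * t) powr (1 / \<alpha>)"
      using t by (simp flip: powr_add)
    \<comment> \<open>Here \<open>t \<le> 1\<close> enters: the base is at most 2 and the exponent
      is non-negative.\<close>
    also have "\<dots> \<le> 2 powr (1 / \<beta> - 1 / \<alpha>) * (2 * t) powr (1 / \<alpha>)"
      using \<open>0 \<le> 1 / \<beta> - 1 / \<alpha>\<close> t by (intro mult_right_mono powr_mono2) auto
    also have "\<dots> \<le> 2 powr (1 / \<beta> - 1 / \<alpha>) * v powr (1 / \<alpha>)"
      using 3 t v by (intro mult_left_mono powr_mono2') auto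
    finally show ?thesis
      using 3 by (simp add: A_bound_def)
  qed
qed

lemma measurable_epowr [measurable]: "(\<lambda>x. epowr x a) \<in> borel_measurable borel"
  unfolding epowr_def by measurable

lemma epowr_ennreal: "0 < x \<Longrightarrow> a \<noteq> 0 \<Longrightarrow> epowr (ennreal x) a = ennreal (x powr a)"
  by (simp add: epowr_def)

text \<open>A nonzero exponent sends 0 and \<infinity> into \<open>{0, \<infinity>}\<close>, so any
  other value comes from a positive real.\<close>

lemma epowr_finite_posE:
  assumes "0 < epowr x a" "epowr x a < \<infinity>" "a \<noteq> 0"
  obtains r where "0 < r" "x = ennreal r"
proof (cases x)
  case (real r)
  with assms that show thesis
    by (cases "r = 0") (auto simp: epowr_def split: if_splits)
qed (use assms in \<open>auto simp: epowr_def split: if_splits\<close>)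

text \<open>The origin is removed so that the set lies in \<open>{0<..}\<close>, as the intervals in
  \<open>P_const\<close> do.\<close>

definition fold_set :: "real set \<Rightarrow> real set" where
  "fold_set I = abs ` I - {0}"

lemma mem_fold_set: "x \<in> fold_set I \<longleftrightarrow> 0 < x \<and> (x \<in> I \<or> - x \<in> I)"
proof
  show "x \<in> fold_set I" if "0 < x \<and> (x \<in> I \<or> - x \<in> I)"
    using that imageI[of x I abs] imageI[of "- x" I abs] by (auto simp: fold_set_def)
qed (auto simp: fold_set_def abs_if)

text \<open>A continuous image of a connected set is connected, and removing 0 from a set of
  non-negative numbers amounts to intersecting it with a ray.\<close>

lemma is_interval_fold_set:
  assumes "is_interval I"
  shows "is_interval (fold_set I)"
proof -
  have "is_interval (abs ` I)"
    using assms unfolding is_interval_connected_1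
    by (intro connected_continuous_image continuous_intros)
  moreover have "fold_set I = abs ` I \<inter> {0<..}"
    by (auto simp: fold_set_def)
  ultimately show ?thesis
    by (simp add: is_interval_Int)
qed

lemma bounded_fold_set: "bounded I \<Longrightarrow> bounded (fold_set I)"
  by (fastforce simp: bounded_iff fold_set_def)

lemma lmeasurable_bounded_interval:
  fixes I :: "real set"
  shows "is_interval I \<Longrightarrow> bounded I \<Longrightarrow> I \<in> lmeasurable"
  by (simp add: is_interval_convex measurable_convex)

text \<open>Reflecting the negative part of \<open>I\<close> turns the integral over
  \<open>I\<close> into one over the half-line with weight
  \<open>indicator I x + indicator I (- x)\<close>, which is 1 or 2 on \<open>fold_set I\<close> and
  0 at all other positive points.\<close>

lemma nn_integral_fold_set:
  fixes g :: "real \<Rightarrow> ennreal"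
  assumes g: "g \<in> borel_measurable (lebesgue_on {0<..})"
    and [measurable]: "I \<in> sets lebesgue" "fold_set I \<in> sets lebesgue"
  shows "(\<integral>\<^sup>+x\<in>fold_set I. g x \<partial>lebesgue) \<le> (\<integral>\<^sup>+x\<in>I. g \<bar>x\<bar> \<partial>lebesgue)"
    and "(\<integral>\<^sup>+x\<in>I. g \<bar>x\<bar> \<partial>lebesgue) \<le> 2 * (\<integral>\<^sup>+x\<in>fold_set I. g x \<partial>lebesgue)"
proof -
  \<comment> \<open>Since \<open>g\<close> is measurable only on the half-line, it is extended by
    zero.\<close>
  define h where "h x = g x * indicator {0<..} x" for x
  have h [measurable]: "h \<in> borel_measurable lebesgue"
    using g by (simp add: h_def[abs_def] borel_measurable_restrict_space_iff_ennreal)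
  have uminus [measurable]: "(\<lambda>x::real. - x) \<in> lebesgue \<rightarrow>\<^sub>M lebesgue"
    using lebesgue_affine_measurable[of "\<lambda>_. - 1" "0::real"] by simp
  \<comment> \<open>At the origin \<open>h\<close> vanishes but \<open>g\<close> may not, so the
    splitting holds only almost everywhere.\<close>
  have "AE x in lebesgue. x \<noteq> (0::real)"
    by (rule AE_I'[of "{0}"]) auto
  then have "AE x in lebesgue. g \<bar>x\<bar> * indicator I x
      = h x * indicator I x + h (- x) * indicator I x"
    by eventually_elim (auto simp: h_def abs_if split: split_indicator)
  then have "(\<integral>\<^sup>+x\<in>I. g \<bar>x\<bar> \<partial>lebesgue)
      = (\<integral>\<^sup>+x. h x * indicator I x + h (- x) * indicator I x \<partial>lebesgue)"
    by (rule nn_integral_cong_AE)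
  also have "\<dots> = (\<integral>\<^sup>+x. h x * indicator I x \<partial>lebesgue) + (\<integral>\<^sup>+x. h (- x) * indicator I x \<partial>lebesgue)"
    by (rule nn_integral_add) measurable
  also have "(\<integral>\<^sup>+x. h (- x) * indicator I x \<partial>lebesgue) = (\<integral>\<^sup>+x. h x * indicator I (- x) \<partial>lebesgue)"
    using nn_integral_real_affine_lebesgue[of "\<lambda>x. h (- x) * indicator I x" "- 1" 0] by simp
  also have "(\<integral>\<^sup>+x. h x * indicator I x \<partial>lebesgue) + \<dots>
      = (\<integral>\<^sup>+x. h x * indicator I x + h x * indicator I (- x) \<partial>lebesgue)"
    by (rule nn_integral_add[symmetric]) measurable
  finally have eq: "(\<integral>\<^sup>+x\<in>I. g \<bar>x\<bar> \<partial>lebesgue)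
      = (\<integral>\<^sup>+x. h x * indicator I x + h x * indicator I (- x) \<partial>lebesgue)" .
  have J: "g x * indicator (fold_set I) x = h x * indicator (fold_set I) x" for x
    by (auto simp: h_def mem_fold_set split: split_indicator)
  show "(\<integral>\<^sup>+x\<in>fold_set I. g x \<partial>lebesgue) \<le> (\<integral>\<^sup>+x\<in>I. g \<bar>x\<bar> \<partial>lebesgue)"
    unfolding eq J
    by (intro nn_integral_mono) (auto simp: mem_fold_set split: split_indicator)
  have "(\<integral>\<^sup>+x\<in>I. g \<bar>x\<bar> \<partial>lebesgue) \<le> (\<integral>\<^sup>+x. 2 * (h x * indicator (fold_set I) x) \<partial>lebesgue)"
    unfolding eq
    by (intro nn_integral_mono)
       (auto simp: h_def mem_fold_set mult_2 split: split_indicator)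
  also have "\<dots> = 2 * (\<integral>\<^sup>+x\<in>fold_set I. g x \<partial>lebesgue)"
    unfolding J by (rule nn_integral_cmult) measurable
  finally show "(\<integral>\<^sup>+x\<in>I. g \<bar>x\<bar> \<partial>lebesgue) \<le> 2 * (\<integral>\<^sup>+x\<in>fold_set I. g x \<partial>lebesgue)" .
qed

lemma fold_set_sets:
  assumes "bdd_interval I"
  shows "I \<in> sets lebesgue" "fold_set I \<in> sets lebesgue"
  using assms
  by (auto simp: bdd_interval_def is_interval_fold_set bounded_fold_set
      intro!: fmeasurableD lmeasurable_bounded_interval)

lemma measure_fold_set:
  assumes "bdd_interval I"
  shows "measure lebesgue (fold_set I) \<le> measure lebesgue I"
    and "measure lebesgue I \<le> 2 * measure lebesgue (fold_set I)"
proof -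
  have I: "I \<in> lmeasurable" and J: "fold_set I \<in> lmeasurable"
    using assms
    by (auto simp: bdd_interval_def is_interval_fold_set bounded_fold_set
        intro!: lmeasurable_bounded_interval)
  have "ennreal (measure lebesgue (fold_set I)) \<le> ennreal (measure lebesgue I)"
    "ennreal (measure lebesgue I) \<le> ennreal (2 * measure lebesgue (fold_set I))"
    using nn_integral_fold_set[of "\<lambda>_. 1" I] I J
    by (simp_all add: fold_set_sets[OF assms] emeasure_eq_measure2 ennreal_mult)
  then show "measure lebesgue (fold_set I) \<le> measure lebesgue I"
    "measure lebesgue I \<le> 2 * measure lebesgue (fold_set I)"
    by (simp_all add: ennreal_le_iff)
qed

text \<open>Positive length follows from the bound of \<open>measure lebesgue I\<close> by twice the
  folded length.\<close>

lemma bdd_interval_fold_set: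
  assumes "bdd_interval I"
  shows "bdd_interval (fold_set I)"
  using assms measure_fold_set(2)[OF assms]
  by (auto simp: bdd_interval_def is_interval_fold_set bounded_fold_set)

text \<open>\<open>x\<close> is the average of the \<open>a\<close>-th power of \<open>f\<close>
  over the folded interval, and \<open>u * x\<close> is the average of its even extension over
  \<open>I\<close>. The bounds on \<open>u\<close> are those on the integrals, divided by the
  lengths.\<close>

lemma power_mean_fold_set:
  fixes I :: "real set"
  defines "t \<equiv> measure lebesgue (fold_set I) / measure lebesgue I"
  assumes I: "bdd_interval I" and f: "f \<in> borel_measurable (lebesgue_on {0<..})" and a: "a \<noteq> 0"
    and pos: "0 < power_mean (fold_set I) a f" and fin: "power_mean (fold_set I) a f < \<infinity>"
  obtains x u where "0 < x" "t \<le> u" "u \<le> 2 * t"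
    "power_mean (fold_set I) a f = ennreal (x powr (1 / a))"
    "power_mean I a (even_ext f) = ennreal (u powr (1 / a) * x powr (1 / a))"
proof -
  let ?J = "fold_set I"
  define m n where "m = measure lebesgue I" and "n = measure lebesgue ?J"
  have m: "0 < m" and n: "0 < n"
    using I bdd_interval_fold_set[OF I] by (auto simp: m_def n_def bdd_interval_def)
  have em: "emeasure lebesgue I = ennreal m" and en: "emeasure lebesgue ?J = ennreal n"
    using I bdd_interval_fold_set[OF I] lmeasurable_bounded_interval
    by (auto simp: m_def n_def bdd_interval_def emeasure_eq_measure2)
  define S where "S = (\<integral>\<^sup>+x\<in>?J. epowr (ennreal (f x)) a \<partial>lebesgue)"
  define T where "T = (\<integral>\<^sup>+x\<in>I. epowr (ennreal (f \<bar>x\<bar>)) a \<partial>lebesgue)"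
  have "(\<lambda>x. epowr (ennreal (f x)) a) \<in> borel_measurable (lebesgue_on {0<..})"
    using f by measurable
  from nn_integral_fold_set[OF this fold_set_sets[OF I]]
  have ST: "S \<le> T" "T \<le> 2 * S"
    by (simp_all add: S_def T_def)
  obtain x where x: "0 < x" "S / ennreal n = ennreal x"
    using pos fin a unfolding power_mean_def S_def[symmetric] en
    by (elim epowr_finite_posE) auto
  obtain s where s: "S = ennreal s" "0 \<le> s"
    using x n by (cases S) (auto simp: ennreal_top_divide)
  then have xs: "x = s / n"
    using x n by (simp add: divide_ennreal)
  with x n have "0 < s"
    by (simp add: zero_less_divide_iff)
  \<comment> \<open>Finiteness over \<open>I\<close> is inherited from the folded interval through
    \<open>T \<le> 2 * S\<close>.\<close>
  obtain r where r: "T = ennreal r" "0 \<le> r"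
    using ST s by (cases T) (auto simp: top_unique ennreal_mult_eq_top_iff)
  have "ennreal s \<le> ennreal r" "ennreal r \<le> ennreal (2 * s)"
    using ST r s by (simp_all add: ennreal_mult)
  then have sr: "s \<le> r" "r \<le> 2 * s"
    using r \<open>0 < s\<close> by (simp_all add: ennreal_le_iff)
  define u where "u = r / m / x"
  have t: "t = n / m"
    by (simp add: t_def m_def n_def)
  have "t \<le> u" "u \<le> 2 * t"
    using sr m n \<open>0 < s\<close> by (simp_all add: u_def t xs field_simps)
  moreover have "0 < u"
    using \<open>t \<le> u\<close> m n by (auto simp: t intro: less_le_trans[OF divide_pos_pos])
  moreover have "power_mean ?J a f = ennreal (x powr (1 / a))"
    using x a by (simp add: power_mean_def S_def[symmetric] en epowr_ennreal)
  moreover have "power_mean I a (even_ext f) = ennreal (u powr (1 / a) * x powr (1 / a))"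
  proof -
    have "power_mean I a (even_ext f) = epowr (ennreal (r / m)) (1 / a)"
      using r m by (simp add: power_mean_def even_ext_def T_def[symmetric] em divide_ennreal)
    also have "r / m = u * x"
      using x by (simp add: u_def)
    also have "epowr (ennreal (u * x)) (1 / a) = ennreal (u powr (1 / a) * x powr (1 / a))"
      using x a \<open>0 < u\<close> by (subst epowr_ennreal) (auto simp: powr_mult)
    finally show ?thesis .
  qed
  ultimately show thesis
    using that x by blast
qed

text \<open>Each interval \<open>I\<close> is compared with its folded interval, which is a
  competitor in the supremum \<open>P_const\<close>. Both exponents share the same \<open>t\<close>,
  as the elementary inequality demands.\<close>

lemma R_const_even_ext_le:
  assumes ab: "\<alpha> < \<beta>" "\<alpha> * \<beta> \<noteq> 0" and f: "f \<in> RHI_class \<alpha> \<beta>"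
  shows "R_const \<alpha> \<beta> (even_ext f) \<le> ennreal (A_bound \<alpha> \<beta>) * P_const \<alpha> \<beta> f"
  unfolding R_const_def
proof (rule SUP_least)
  fix I :: "real set"
  assume "I \<in> {I. bdd_interval I}"
  then have I: "bdd_interval I"
    by simp
  define J where "J = fold_set I"
  define t where "t = measure lebesgue J / measure lebesgue I"
  have J: "bdd_interval J" "J \<subseteq> {0<..}"
    using bdd_interval_fold_set[OF I] by (auto simp: J_def mem_fold_set)
  have t: "1 / 2 \<le> t" "t \<le> 1"
    using measure_fold_set[OF I] I by (auto simp: t_def J_def bdd_interval_def field_simps)
  have meas: "f \<in> borel_measurable (lebesgue_on {0<..})"
    and means: "0 < power_mean J \<alpha> f" "power_mean J \<alpha> f < \<infinity>"
      "0 < power_mean J \<beta> f" "power_mean J \<beta> f < \<infinity>"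
    using f J by (auto simp: RHI_class_def)
  have nz: "\<alpha> \<noteq> 0" "\<beta> \<noteq> 0"
    using ab by auto
  obtain x v where x: "0 < x" and v: "t \<le> v" "v \<le> 2 * t"
    and \<alpha>: "power_mean J \<alpha> f = ennreal (x powr (1 / \<alpha>))"
      "power_mean I \<alpha> (even_ext f) = ennreal (v powr (1 / \<alpha>) * x powr (1 / \<alpha>))"
    using power_mean_fold_set[OF I meas nz(1)] means unfolding J_def t_def by blast
  obtain y u where y: "0 < y" and u: "t \<le> u" "u \<le> 2 * t"
    and \<beta>: "power_mean J \<beta> f = ennreal (y powr (1 / \<beta>))"
      "power_mean I \<beta> (even_ext f) = ennreal (u powr (1 / \<beta>) * y powr (1 / \<beta>))"
    using power_mean_fold_set[OF I meas nz(2)] means unfolding J_def t_def by blast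
  have "0 < v"
    using t v by linarith
  have A: "0 \<le> A_bound \<alpha> \<beta>"
    by (simp add: A_bound_def)
  \<comment> \<open>The quotient splits into a distortion factor, bounded by \<open>A_bound\<close>,
    and the quotient for \<open>J\<close>.\<close>
  have "power_mean I \<beta> (even_ext f) / power_mean I \<alpha> (even_ext f)
      = ennreal (u powr (1 / \<beta>) / v powr (1 / \<alpha>) * (y powr (1 / \<beta>) / x powr (1 / \<alpha>)))"
    using x \<open>0 < v\<close> by (simp add: \<alpha> \<beta> divide_ennreal)
  also have "\<dots> \<le> ennreal (A_bound \<alpha> \<beta> * (y powr (1 / \<beta>) / x powr (1 / \<alpha>)))"
    using powr_le_A_bound[OF ab t u v] \<open>0 < v\<close>
    by (intro ennreal_leI mult_right_mono) (simp_all add: pos_divide_le_eq)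
  also have "\<dots> = ennreal (A_bound \<alpha> \<beta>) * (power_mean J \<beta> f / power_mean J \<alpha> f)"
    using x A by (simp only: \<alpha> \<beta> divide_ennreal ennreal_mult powr_gt_zero powr_ge_zero
        divide_nonneg_nonneg)
  also have "\<dots> \<le> ennreal (A_bound \<alpha> \<beta>) * P_const \<alpha> \<beta> f"
    unfolding P_const_def using J by (intro mult_left_mono SUP_upper) auto
  finally show "power_mean I \<beta> (even_ext f) / power_mean I \<alpha> (even_ext f)
      \<le> ennreal (A_bound \<alpha> \<beta>) * P_const \<alpha> \<beta> f" .
qed

theorem theorem1:
  fixes \<alpha> \<beta> :: real
  assumes "\<alpha> < \<beta>" and "\<alpha> * \<beta> \<noteq> 0"
  shows "A_const \<alpha> \<beta> \<le> ennreal (A_bound \<alpha> \<beta>)"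
  unfolding A_const_def
proof (rule SUP_least)
  fix f
  assume f: "f \<in> RHI_class \<alpha> \<beta>"
  note le = R_const_even_ext_le[OF assms f]
  show "R_const \<alpha> \<beta> (even_ext f) / P_const \<alpha> \<beta> f \<le> ennreal (A_bound \<alpha> \<beta>)"
  \<comment> \<open>If the denominator is 0, the bound forces the numerator to be 0, and
    \<open>0 / 0 = 0\<close> in \<open>ennreal\<close>.\<close>
  proof (cases "P_const \<alpha> \<beta> f = 0")
    case True
    with le show ?thesis
      by simp
  next
    case False
    with le show ?thesis
      by (intro divide_le_posI_ennreal) (simp_all add: mult.commute zero_less_iff_neq_zero)
  qed
qed

end
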